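(* Let $B$ be a finite-dimensional algebra over a field $\Bbbk$ and let $A=B\oplus D(B)$ be its trivial extension. An element of $A$ is the Nakayama Jacobian of an algebra automorphism of $A$ (with respect to the canonical symmetric bilinear form of $A$) if and only if it is of the form $t+\tau$ with $t$ a central unit of $B$ and $\tau:B\to\Bbbk$ an element of $D(B)$ in the image of the transposed map $$\mathsf{B}^{\mathsf T}:\mathrm{HH}_1(B)^*\to\mathrm{HH}_0(B)^*$$ of the Connes boundary $\mathsf{B}:\mathrm{HH}_0(B)\to\mathrm{HH}_1(B)$. Here elements of $\mathrm{HH}_0(B)^*$ are identified with linear maps $B\to\Bbbk$ that vanish on commutators.
   Context: Algebras are associative and unital over $\Bbbk$. $D(B)=\mathrm{Hom}_\Bbbk(B,\Bbbk)$ is a $B$-bimodule via $(x\lambda y)(b)=\lambda(ybx)$. The trivial extension is $A=B\oplus D(B)$ with product $(x,x')(y,y')=(xy,xy'+x'y)$; the bilinear form $\langle(x,x'),(y,y')\rangle=x'(y)+y'(x)$ on $A$ is non-degenerate, associative and symmetric. The Nakayama Jacobian $\mathrm{jac}_\sigma(u)$ of an algebra automorphism $u:A\to A$ is the unique element of $A$ with $\langle u(a),u(b)\rangle=\langle\mathrm{jac}_\sigma(u)\cdot a,b\rangle$ for all $a,b\in A$ (here the Nakayama automorphism $\sigma$ is the identity). $\mathrm{HH}_*(B)$ is Hochschild homology: $\mathrm{HH}_0(B)=B/[B,B]$, with $[B,B]$ the span of commutators, and $\mathrm{HH}_1(B)$ is the quotient of $\ker(B\otimes B\to B,\ x\otimes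 y\mapsto xy-yx)$ by the span of the elements $xy\otimes z-x\otimes yz+zx\otimes y$. The Connes boundary $\mathsf{B}:\mathrm{HH}_0(B)\to\mathrm{HH}_1(B)$ sends the class of $x$ to the class of $1\otimes x+x\otimes 1$. The symbol $(-)^*$ denotes the dual vector space. *)

theory Defs
  imports Complex_Main "HOL-Library.Poly_Mapping"
begin

text \<open>
  The underlying ring of an algebra is a type of sort \<open>{ring, monoid_mult}\<close>
  rather than \<open>ring_1\<close>, so that the zero algebra is not excluded.
\<close>

locale algebra_over_field = vector_space scale
  for scale :: "'k::field \<Rightarrow> 'b::{ring,monoid_mult} \<Rightarrow> 'b" +
  assumes scale_mult_left: "scale c x * y = scale c (x * y)"
    and scale_mult_right: "x * scale c y = scale c (x * y)"

definition finite_dimensional :: "('k::field \<Rightarrow> 'v::ab_group_add \<Rightarrow> 'v) \<Rightarrow> bool" where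
  "finite_dimensional s \<longleftrightarrow> (\<exists>S. finite S \<and> module.span s S = UNIV)"


section \<open>Vector spaces on a carrier set\<close>

text \<open>
  Quotients are formed by a subspace that depends on the scalar multiplication, a term,
  so they are sets of cosets and not types.
\<close>

record ('k, 'v) vspace =
  vcarrier :: "'v set"
  vadd :: "'v \<Rightarrow> 'v \<Rightarrow> 'v"
  vzero :: "'v"
  vscale :: "'k \<Rightarrow> 'v \<Rightarrow> 'v"

record ('k, 'v) alg = "('k, 'v) vspace" +
  amult :: "'v \<Rightarrow> 'v \<Rightarrow> 'v"
  aone :: "'v"

definition vspace_of :: "('k \<Rightarrow> 'v::ab_group_add \<Rightarrow> 'v) \<Rightarrow> ('k, 'v) vspace" where
  "vspace_of s = \<lparr>vcarrier = UNIV, vadd = (+), vzero = 0, vscale = s\<rparr>"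

definition vlinear ::
    "('k, 'v, 'x) vspace_scheme \<Rightarrow> ('k, 'w, 'y) vspace_scheme \<Rightarrow> ('v \<Rightarrow> 'w) \<Rightarrow> bool" where
  "vlinear V W f \<longleftrightarrow>
     (\<forall>v\<in>vcarrier V. f v \<in> vcarrier W) \<and>
     (\<forall>v\<in>vcarrier V. \<forall>v'\<in>vcarrier V. f (vadd V v v') = vadd W (f v) (f v')) \<and>
     (\<forall>c. \<forall>v\<in>vcarrier V. f (vscale V c v) = vscale W c (f v))"

definition vdual :: "('k::field, 'v, 'x) vspace_scheme \<Rightarrow> ('v \<Rightarrow> 'k) set" where
  "vdual V = {\<phi>. vlinear V (vspace_of (*)) \<phi>}"

definition vsubspace :: "('k, 'v, 'x) vspace_scheme \<Rightarrow> 'v set \<Rightarrow> bool" where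
  "vsubspace V U \<longleftrightarrow>
     U \<subseteq> vcarrier V \<and> vzero V \<in> U \<and>
     (\<forall>u\<in>U. \<forall>u'\<in>U. vadd V u u' \<in> U) \<and> (\<forall>c. \<forall>u\<in>U. vscale V c u \<in> U)"

definition vspan :: "('k, 'v, 'x) vspace_scheme \<Rightarrow> 'v set \<Rightarrow> 'v set" where
  "vspan V S = \<Inter>{U. vsubspace V U \<and> S \<subseteq> U}"

definition vcoset :: "('k, 'v, 'x) vspace_scheme \<Rightarrow> 'v set \<Rightarrow> 'v \<Rightarrow> 'v set" where
  "vcoset V U v = {vadd V v u | u. u \<in> U}"

text \<open>In \<open>vscale\<close>, adding \<open>U\<close> is only needed for the scalar \<open>0\<close>.\<close>

definition vquotient :: "('k, 'v, 'x) vspace_scheme \<Rightarrow> 'v set \<Rightarrow> ('k, 'v set) vspace" where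
  "vquotient V U =
     \<lparr>vcarrier = vcoset V U ` vcarrier V,
      vadd = (\<lambda>C D. {vadd V v w | v w. v \<in> C \<and> w \<in> D}),
      vzero = U,
      vscale = (\<lambda>c C. {vadd V (vscale V c v) u | v u. v \<in> C \<and> u \<in> U})\<rparr>"


section \<open>Tensor products\<close>

definition free_scale :: "'k::field \<Rightarrow> ('i \<Rightarrow>\<^sub>0 'k) \<Rightarrow> ('i \<Rightarrow>\<^sub>0 'k)" where
  "free_scale c p = Poly_Mapping.map ((*) c) p"

abbreviation free_gen :: "'i \<Rightarrow> ('i \<Rightarrow>\<^sub>0 'k::field)" where
  "free_gen i \<equiv> Poly_Mapping.single i 1"

definition bilinear_relations ::
    "('k::field \<Rightarrow> 'v::ab_group_add \<Rightarrow> 'v) \<Rightarrow> ('k \<Rightarrow> 'w::ab_group_add \<Rightarrow> 'w) \<Rightarrow> ('v \<times> 'w \<Rightarrow>\<^sub>0 'k) set" where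
  "bilinear_relations s s' = module.span free_scale (
     {free_gen (v + v', w) - free_gen (v, w) - free_gen (v', w) | v v' w. True} \<union>
     {free_gen (v, w + w') - free_gen (v, w) - free_gen (v, w') | v w w'. True} \<union>
     {free_gen (s c v, w) - free_scale c (free_gen (v, w)) | c v w. True} \<union>
     {free_gen (v, s' c w) - free_scale c (free_gen (v, w)) | c v w. True})"

definition tensor_space ::
    "('k::field \<Rightarrow> 'v::ab_group_add \<Rightarrow> 'v) \<Rightarrow> ('k \<Rightarrow> 'w::ab_group_add \<Rightarrow> 'w)
      \<Rightarrow> ('k, ('v \<times> 'w \<Rightarrow>\<^sub>0 'k) set) vspace" where
  "tensor_space s s' = vquotient (vspace_of free_scale) (bilinear_relations s s')"

definition tensor ::
    "('k::field \<Rightarrow> 'v::ab_group_add \<Rightarrow> 'v) \<Rightarrow> ('k \<Rightarrow> 'w::ab_group_add \<Rightarrow> 'w)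
      \<Rightarrow> 'v \<Rightarrow> 'w \<Rightarrow> ('v \<times> 'w \<Rightarrow>\<^sub>0 'k) set" where
  "tensor s s' v w = vcoset (vspace_of free_scale) (bilinear_relations s s') (free_gen (v, w))"

text \<open>
  The linear map on the tensor product induced by a bilinear map \<open>\<beta>\<close> into the space with
  scalar multiplication \<open>r\<close>; the image of a coset under the linear extension of \<open>\<beta>\<close> to the
  free vector space is a singleton.
\<close>

definition tensor_lift ::
    "('k::field \<Rightarrow> 'u::ab_group_add \<Rightarrow> 'u) \<Rightarrow> ('v \<Rightarrow> 'w \<Rightarrow> 'u) \<Rightarrow> ('v \<times> 'w \<Rightarrow>\<^sub>0 'k) set \<Rightarrow> 'u" where
  "tensor_lift r \<beta> t =
     the_elem ((\<lambda>p. \<Sum>(v, w)\<in>Poly_Mapping.keys p. r (Poly_Mapping.lookup p (v, w)) (\<beta> v w)) ` t)"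


section \<open>Hochschild homology in degrees 0 and 1 and the Connes boundary\<close>

definition commutator_space :: "('k::field \<Rightarrow> 'b::{ring,monoid_mult} \<Rightarrow> 'b) \<Rightarrow> 'b set" where
  "commutator_space scale = module.span scale {x * y - y * x | x y. True}"

definition HH0 :: "('k::field \<Rightarrow> 'b::{ring,monoid_mult} \<Rightarrow> 'b) \<Rightarrow> ('k, 'b set) vspace" where
  "HH0 scale = vquotient (vspace_of scale) (commutator_space scale)"

definition HH0_class :: "('k::field \<Rightarrow> 'b::{ring,monoid_mult} \<Rightarrow> 'b) \<Rightarrow> 'b \<Rightarrow> 'b set" where
  "HH0_class scale x = vcoset (vspace_of scale) (commutator_space scale) x"

definition HH1_cycles ::
    "('k::field \<Rightarrow> 'b::{ring,monoid_mult} \<Rightarrow> 'b) \<Rightarrow> ('b \<times> 'b \<Rightarrow>\<^sub>0 'k) set set" where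
  "HH1_cycles scale =
     {t \<in> vcarrier (tensor_space scale scale). tensor_lift scale (\<lambda>x y. x * y - y * x) t = 0}"

definition HH1_boundaries ::
    "('k::field \<Rightarrow> 'b::{ring,monoid_mult} \<Rightarrow> 'b) \<Rightarrow> ('b \<times> 'b \<Rightarrow>\<^sub>0 'k) set set" where
  "HH1_boundaries scale =
     (let T = tensor_space scale scale; tens = tensor scale scale in
      vspan T {vadd T (vadd T (tens (x * y) z) (vscale T (- 1) (tens x (y * z)))) (tens (z * x) y)
               | x y z. True})"

definition HH1_cycle_space ::
    "('k::field \<Rightarrow> 'b::{ring,monoid_mult} \<Rightarrow> 'b) \<Rightarrow> ('k, ('b \<times> 'b \<Rightarrow>\<^sub>0 'k) set) vspace" where
  "HH1_cycle_space scale = (tensor_space scale scale)\<lparr>vcarrier := HH1_cycles scale\<rparr>"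

definition HH1 ::
    "('k::field \<Rightarrow> 'b::{ring,monoid_mult} \<Rightarrow> 'b) \<Rightarrow> ('k, ('b \<times> 'b \<Rightarrow>\<^sub>0 'k) set set) vspace" where
  "HH1 scale = vquotient (HH1_cycle_space scale) (HH1_boundaries scale)"

definition HH1_class ::
    "('k::field \<Rightarrow> 'b::{ring,monoid_mult} \<Rightarrow> 'b) \<Rightarrow> ('b \<times> 'b \<Rightarrow>\<^sub>0 'k) set
      \<Rightarrow> ('b \<times> 'b \<Rightarrow>\<^sub>0 'k) set set" where
  "HH1_class scale t = vcoset (HH1_cycle_space scale) (HH1_boundaries scale) t"

text \<open>The argument \<open>C\<close> is a coset of the commutator space, i.e. an element of \<open>HH0\<close>.\<close>

definition connes_boundary ::
    "('k::field \<Rightarrow> 'b::{ring,monoid_mult} \<Rightarrow> 'b) \<Rightarrow> 'b set \<Rightarrow> ('b \<times> 'b \<Rightarrow>\<^sub>0 'k) set set" where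
  "connes_boundary scale C =
     the_elem ((\<lambda>x. HH1_class scale
        (vadd (tensor_space scale scale) (tensor scale scale 1 x) (tensor scale scale x 1))) ` C)"

definition connes_transpose ::
    "('k::field \<Rightarrow> 'b::{ring,monoid_mult} \<Rightarrow> 'b)
      \<Rightarrow> (('b \<times> 'b \<Rightarrow>\<^sub>0 'k) set set \<Rightarrow> 'k) \<Rightarrow> ('b set \<Rightarrow> 'k)" where
  "connes_transpose scale \<phi> = \<phi> \<circ> connes_boundary scale"

text \<open>
  A functional \<open>\<psi>\<close> on \<open>HH0\<close>, viewed as a linear map on the algebra vanishing on commutators.
\<close>

definition HH0_dual_pullback ::
    "('k::field \<Rightarrow> 'b::{ring,monoid_mult} \<Rightarrow> 'b) \<Rightarrow> ('b set \<Rightarrow> 'k) \<Rightarrow> ('b \<Rightarrow> 'k)" where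
  "HH0_dual_pullback scale \<psi> = \<psi> \<circ> HH0_class scale"


section \<open>The trivial extension and Nakayama Jacobians\<close>

definition linear_dual :: "('k::field \<Rightarrow> 'b::ab_group_add \<Rightarrow> 'b) \<Rightarrow> ('b \<Rightarrow> 'k) set" where
  "linear_dual scale = {f. Vector_Spaces.linear scale (*) f}"

definition dual_lmult :: "'b::{ring,monoid_mult} \<Rightarrow> ('b \<Rightarrow> 'k) \<Rightarrow> ('b \<Rightarrow> 'k)" where
  "dual_lmult x f = (\<lambda>b. f (b * x))"

definition dual_rmult :: "('b \<Rightarrow> 'k) \<Rightarrow> 'b::{ring,monoid_mult} \<Rightarrow> ('b \<Rightarrow> 'k)" where
  "dual_rmult f y = (\<lambda>b. f (y * b))"

definition trivial_extension ::
    "('k::field \<Rightarrow> 'b::{ring,monoid_mult} \<Rightarrow> 'b) \<Rightarrow> ('k, 'b \<times> ('b \<Rightarrow> 'k)) alg" where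
  "trivial_extension scale =
     \<lparr>vcarrier = UNIV \<times> linear_dual scale,
      vadd = (\<lambda>(x, f) (y, g). (x + y, \<lambda>b. f b + g b)),
      vzero = (0, \<lambda>b. 0),
      vscale = (\<lambda>c (x, f). (scale c x, \<lambda>b. c * f b)),
      amult = (\<lambda>(x, f) (y, g). (x * y, \<lambda>b. dual_lmult x g b + dual_rmult f y b)),
      aone = (1, \<lambda>b. 0)\<rparr>"

fun canonical_form :: "'b \<times> ('b \<Rightarrow> 'k::field) \<Rightarrow> 'b \<times> ('b \<Rightarrow> 'k) \<Rightarrow> 'k" where
  "canonical_form (x, f) (y, g) = f y + g x"

definition algebra_automorphism :: "('k, 'v, 'x) alg_scheme \<Rightarrow> ('v \<Rightarrow> 'v) \<Rightarrow> bool" where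
  "algebra_automorphism A u \<longleftrightarrow>
     bij_betw u (vcarrier A) (vcarrier A) \<and> vlinear A A u \<and>
     (\<forall>a\<in>vcarrier A. \<forall>b\<in>vcarrier A. u (amult A a b) = amult A (u a) (u b)) \<and>
     u (aone A) = aone A"

definition nakayama_jacobian ::
    "('k, 'v, 'x) alg_scheme \<Rightarrow> ('v \<Rightarrow> 'v \<Rightarrow> 'k) \<Rightarrow> ('v \<Rightarrow> 'v) \<Rightarrow> 'v" where
  "nakayama_jacobian A \<beta> u =
     (THE j. j \<in> vcarrier A \<and>
        (\<forall>a\<in>vcarrier A. \<forall>b\<in>vcarrier A. \<beta> (u a) (u b) = \<beta> (amult A j a) b))"

definition central_unit :: "'b::{ring,monoid_mult} \<Rightarrow> bool" where
  "central_unit t \<longleftrightarrow> (\<forall>x. t * x = x * t) \<and> (\<exists>s. t * s = 1 \<and> s * t = 1)"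

end

theory Submission
  imports Defs
begin

text \<open>
  Extending a functional on \<open>HH1\<close> from cycles to all of \<open>B \<otimes> B\<close> turns it into a bilinear form
  \<open>\<Phi>\<close> with \<open>\<Phi>(xy, z) - \<Phi>(x, yz) + \<Phi>(zx, y) = 0\<close>, i.e. into a derivation \<open>y \<mapsto> \<Phi>(-, y)\<close> from \<open>B\<close>
  to \<open>D(B)\<close>. As \<open>\<Phi>(x, 1) = 0\<close>, its image under the transposed Connes boundary is \<open>\<Phi>(1, -)\<close>.

  For such \<open>\<Phi>\<close> and a central unit \<open>t\<close>, the map \<open>(x, f) \<mapsto> (x, \<Phi>(-, x) + t f)\<close> is an automorphism
  with Jacobian \<open>(t, \<Phi>(1, -))\<close>. Conversely, let \<open>u\<close> be an automorphism, with \<open>u(x, 0) = (\<alpha> x, \<delta> x)\<close>.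
  Its Jacobian \<open>j = (t, \<tau>)\<close> represents \<open>a \<mapsto> \<langle>u a, 1\<rangle>\<close>, so \<open>\<tau> x = \<delta>(x)(1)\<close>, and \<open>j\<close> is central by
  symmetry of the form. Multiplication by \<open>j\<close> is injective; on \<open>D(B)\<close> it is dual to
  multiplication by \<open>t\<close> on \<open>B\<close>, so \<open>t\<close> is a unit. Finally \<open>\<Phi>(b, x) = \<delta>(x)(\<alpha> b)\<close> is a cocycle
  with \<open>\<Phi>(1, -) = \<tau>\<close>.
\<close>

section \<open>Linear functionals\<close>

lemma vector_space_field: "vector_space ((*) :: 'k::field \<Rightarrow> 'k \<Rightarrow> 'k)"
  by unfold_locales (simp_all add: algebra_simps)

context vector_space
begin

lemma linear_dual_iff:
  "f \<in> linear_dual scale \<longleftrightarrow>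
     (\<forall>x y. f (x + y) = f x + f y) \<and> (\<forall>c x. f (scale c x) = c * f x)"
  by (simp add: linear_dual_def Vector_Spaces.linear_iff vector_space_field vector_space_axioms)

lemma linear_dual_zero:
  assumes "f \<in> linear_dual scale"
  shows "f 0 = 0"
proof -
  have "f (scale 0 0) = 0 * f 0" using assms unfolding linear_dual_iff by blast
  then show ?thesis by simp
qed

text \<open>A basis of W stays independent when x is adjoined, so a functional may be prescribed as
  0 on that basis and 1 at x. This separation property replaces dimension counts in what
  follows.\<close>

lemma exists_functional_separating:
  assumes "subspace W" "x \<notin> W"
  shows "\<exists>f\<in>linear_dual scale. (\<forall>w\<in>W. f w = 0) \<and> f x = 1"
proof -
  interpret vector_space_pair scale "(*) :: 'a \<Rightarrow> 'a \<Rightarrow> 'a"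
    by (intro vector_space_pair.intro vector_space_axioms vector_space_field)
  obtain S where S: "S \<subseteq> W" "independent S" "W \<subseteq> span S"
    using maximal_independent_subset by blast
  have SW: "span S = W"
    using S assms(1) span_subspace by blast
  then have "independent (insert x S)"
    using S assms(2) independent_insertI by blast
  then obtain f where f: "Vector_Spaces.linear scale (*) f" "\<forall>y\<in>insert x S. f y = (if y = x then 1 else 0)"
    using linear_independent_extend[of "insert x S" "\<lambda>y. if y = x then 1 else 0"] by blast
  have fS: "f y = 0" if "y \<in> S" for y
    using f(2) that S(1) assms(2) by auto
  have "f w = 0" if "w \<in> W" for w
    using linear_eq_0_on_span[OF f(1) fS] that SW by simp
  with f show ?thesis
    by (auto simp: linear_dual_def)
qed

lemma linear_dual_separates:
  assumes "\<And>f. f \<in> linear_dual scale \<Longrightarrow> f x = f y"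
  shows "x = y"
proof (rule ccontr)
  assume "x \<noteq> y"
  then obtain f where f: "f \<in> linear_dual scale" "f (x - y) = 1"
    using exists_functional_separating[of "{0}" "x - y"] by (auto simp: subspace_def)
  have "f (x - y + y) = f (x - y) + f y"
    using f(1) unfolding linear_dual_iff by blast
  then show False
    using f assms[OF f(1)] by simp
qed

text \<open>This is reflexivity: a basis D with coordinate functionals \<open>e d\<close> gives t as
  the sum of \<open>scale (F (e d)) d\<close>. Finite dimension enters the theorem here. F has to be
  linear only on the dual, which is a set of functions and not a type.\<close>

lemma functional_on_dual_is_evaluation:
  assumes fin: "finite_dimensional scale"
    and add: "\<And>f g. f \<in> linear_dual scale \<Longrightarrow> g \<in> linear_dual scale \<Longrightarrow>
                F (\<lambda>b. f b + g b) = F f + F g"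
    and scl: "\<And>c f. f \<in> linear_dual scale \<Longrightarrow> F (\<lambda>b. c * f b) = c * F f"
  shows "\<exists>t. \<forall>f\<in>linear_dual scale. F f = f t"
proof -
  obtain S where S: "finite S" "span S = UNIV"
    using fin unfolding finite_dimensional_def by blast
  obtain D where D: "D \<subseteq> S" "independent D" "S \<subseteq> span D"
    using maximal_independent_subset by blast
  have finD: "finite D" using D(1) S(1) finite_subset by blast
  have spanD: "span D = UNIV"
    using S(2) D(3) span_mono span_span by (metis UNIV_eq_I UNIV_I subsetD)
  define e where "e d v = representation D v d" for d v
  have e: "e d \<in> linear_dual scale" for d
    unfolding e_def linear_dual_def using linear_representation[OF D(2) spanD] by simp
  have lin_sum: "f (\<Sum>d\<in>E. scale (c d) d) = (\<Sum>d\<in>E. c d * f d)"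
    if f: "f \<in> linear_dual scale" "finite E" for f c E
    using f(2)
  proof induction
    case empty
    show ?case using linear_dual_zero[OF f(1)] by simp
  next
    case (insert x E)
    then show ?case using f(1) by (simp add: linear_dual_iff)
  qed
  have F_sum: "(\<lambda>b. \<Sum>d\<in>E. c d * e d b) \<in> linear_dual scale \<and>
      F (\<lambda>b. \<Sum>d\<in>E. c d * e d b) = (\<Sum>d\<in>E. c d * F (e d))" if "finite E" for E c
    using that
  proof induction
    case empty
    \<comment> \<open>The value of F at the zero functional is found as a zero multiple;
      \<open>e undefined\<close> stands for an arbitrary element of the dual.\<close>
    have "F (\<lambda>b. 0 * e undefined b) = 0 * F (e undefined)"
      using scl e by blast
    then show ?case by (simp add: linear_dual_iff)
  next
    case (insert x E)
    have "(\<lambda>b. c x * e x b) \<in> linear_dual scale"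
      using e[of x] by (simp add: linear_dual_iff algebra_simps)
    then show ?case
      using insert add[of "\<lambda>b. c x * e x b" "\<lambda>b. \<Sum>d\<in>E. c d * e d b"] e[of x] scl[of "e x" "c x"]
      by (auto simp: linear_dual_iff algebra_simps)
  qed
  have "F f = f (\<Sum>d\<in>D. scale (F (e d)) d)" if f: "f \<in> linear_dual scale" for f
  proof -
    have "f b = (\<Sum>d\<in>D. f d * e d b)" for b
    proof -
      have "b = (\<Sum>d\<in>D. scale (e d b) d)"
        unfolding e_def
        using sum_representation_eq[OF D(2) _ finD, of b] spanD by simp
      then have "f b = (\<Sum>d\<in>D. e d b * f d)"
        using lin_sum[OF f finD] by metis
      then show ?thesis by (simp add: mult.commute)
    qed
    then have "f = (\<lambda>b. \<Sum>d\<in>D. f d * e d b)" by blast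
    then have "F f = (\<Sum>d\<in>D. f d * F (e d))"
      using F_sum[OF finD, of f] by simp
    also have "\<dots> = f (\<Sum>d\<in>D. scale (F (e d)) d)"
      by (simp add: lin_sum[OF f finD] mult.commute)
    finally show ?thesis .
  qed
  then show ?thesis by blast
qed

text \<open>Composing with such a projection extends a linear map from W to the whole space;
  functionals on cycles will be extended in this way.\<close>

lemma exists_projection:
  assumes "subspace W"
  shows "\<exists>\<pi>. (\<forall>x. \<pi> x \<in> W) \<and> Vector_Spaces.linear scale scale \<pi> \<and> (\<forall>w\<in>W. \<pi> w = w)"
proof -
  interpret vector_space_pair scale scale
    by (intro vector_space_pair.intro vector_space_axioms)
  show ?thesis
    using linear_exists_left_inverse_on[of "\<lambda>x. x" W] assms linear_ident
    by (auto simp: image_subset_iff)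
qed

end


section \<open>Vector spaces on a carrier set and their quotients\<close>

text \<open>The records have no negation, so inverses are expressed by the scalar -1.\<close>

locale vspace_on =
  fixes V :: "('k::field, 'v, 'x) vspace_scheme"
  assumes zero_closed: "vzero V \<in> vcarrier V"
    and add_closed: "\<lbrakk>v \<in> vcarrier V; w \<in> vcarrier V\<rbrakk> \<Longrightarrow> vadd V v w \<in> vcarrier V"
    and scale_closed: "v \<in> vcarrier V \<Longrightarrow> vscale V c v \<in> vcarrier V"
    and add_assoc: "\<lbrakk>v \<in> vcarrier V; w \<in> vcarrier V; z \<in> vcarrier V\<rbrakk> \<Longrightarrow>
          vadd V (vadd V v w) z = vadd V v (vadd V w z)"
    and add_commute: "\<lbrakk>v \<in> vcarrier V; w \<in> vcarrier V\<rbrakk> \<Longrightarrow> vadd V v w = vadd V w v"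
    and add_zero: "v \<in> vcarrier V \<Longrightarrow> vadd V v (vzero V) = v"
    and add_neg: "v \<in> vcarrier V \<Longrightarrow> vadd V v (vscale V (- 1) v) = vzero V"
    and scale_add: "\<lbrakk>v \<in> vcarrier V; w \<in> vcarrier V\<rbrakk> \<Longrightarrow>
          vscale V c (vadd V v w) = vadd V (vscale V c v) (vscale V c w)"
    and add_scale: "v \<in> vcarrier V \<Longrightarrow>
          vscale V (c + d) v = vadd V (vscale V c v) (vscale V d v)"
    and scale_scale: "v \<in> vcarrier V \<Longrightarrow> vscale V c (vscale V d v) = vscale V (c * d) v"
    and scale_one: "v \<in> vcarrier V \<Longrightarrow> vscale V 1 v = v"
begin

lemma add_left_commute:
  "\<lbrakk>v \<in> vcarrier V; w \<in> vcarrier V; z \<in> vcarrier V\<rbrakk> \<Longrightarrow>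
    vadd V v (vadd V w z) = vadd V w (vadd V v z)"
  by (metis add_assoc add_commute)

lemma subspace_vspan: "S \<subseteq> vcarrier V \<Longrightarrow> vsubspace V (vspan V S)"
  and vspan_superset: "S \<subseteq> vspan V S"
  and vspan_minimal: "\<lbrakk>vsubspace V U; S \<subseteq> U\<rbrakk> \<Longrightarrow> vspan V S \<subseteq> U"
proof -
  show "vsubspace V (vspan V S)" if "S \<subseteq> vcarrier V"
  proof -
    have "vsubspace V (vcarrier V)"
      by (simp add: vsubspace_def zero_closed add_closed scale_closed)
    with that have "vspan V S \<subseteq> vcarrier V"
      unfolding vspan_def by blast
    then show ?thesis
      unfolding vsubspace_def vspan_def by blast
  qed
  show "S \<subseteq> vspan V S" "\<lbrakk>vsubspace V U; S \<subseteq> U\<rbrakk> \<Longrightarrow> vspan V S \<subseteq> U"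
    unfolding vspan_def by blast+
qed

lemma vspace_on_subspace: "vsubspace V W \<Longrightarrow> vspace_on (V\<lparr>vcarrier := W\<rparr>)"
  unfolding vsubspace_def
  by unfold_locales
    (auto simp: subset_iff add_assoc add_zero add_neg scale_add add_scale
      scale_scale scale_one intro: add_commute)

section \<open>Arithmetic of cosets on representatives\<close>

context
  fixes U
  assumes U: "vsubspace V U"
begin

lemma subD: "u \<in> U \<Longrightarrow> u \<in> vcarrier V"
  using U by (auto simp: vsubspace_def)

lemma sub_closed:
  "vzero V \<in> U" "\<lbrakk>u \<in> U; u' \<in> U\<rbrakk> \<Longrightarrow> vadd V u u' \<in> U" "u \<in> U \<Longrightarrow> vscale V c u \<in> U"
  using U by (auto simp: vsubspace_def)

lemma coset_add:
  assumes "v \<in> vcarrier V" "w \<in> vcarrier V"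
  shows "vadd (vquotient V U) (vcoset V U v) (vcoset V U w) = vcoset V U (vadd V v w)"
proof -
  have *: "vadd V (vadd V v u) (vadd V w u') = vadd V (vadd V v w) (vadd V u u')"
    if "u \<in> U" "u' \<in> U" for u u'
    using assms subD that by (simp add: add_assoc add_left_commute add_closed)
  \<comment> \<open>The sum of cosets is formed elementwise, so a member of the coset of v + w must
    be split between the two cosets: v takes all of u and w takes zero.\<close>
  have **: "vadd V (vadd V v w) u = vadd V (vadd V v u) (vadd V w (vzero V))" if "u \<in> U" for u
    using *[OF that sub_closed(1)] add_zero subD that by simp
  show ?thesis
  proof (intro subset_antisym subsetI)
    fix z assume "z \<in> vadd (vquotient V U) (vcoset V U v) (vcoset V U w)"
    then obtain u u' where "u \<in> U" "u' \<in> U" "z = vadd V (vadd V v u) (vadd V w u')"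
      unfolding vquotient_def vcoset_def by auto
    then show "z \<in> vcoset V U (vadd V v w)"
      unfolding vcoset_def using * sub_closed(2) by auto
  next
    fix z assume "z \<in> vcoset V U (vadd V v w)"
    then obtain u where "u \<in> U" "z = vadd V (vadd V v u) (vadd V w (vzero V))"
      unfolding vcoset_def using ** by auto
    then show "z \<in> vadd (vquotient V U) (vcoset V U v) (vcoset V U w)"
      unfolding vquotient_def vcoset_def using sub_closed(1) by auto
  qed
qed

lemma coset_scale:
  assumes "v \<in> vcarrier V"
  shows "vscale (vquotient V U) c (vcoset V U v) = vcoset V U (vscale V c v)"
proof -
  have *: "vadd V (vscale V c (vadd V v u)) u' = vadd V (vscale V c v) (vadd V (vscale V c u) u')"
    if "u \<in> U" "u' \<in> U" for u u'
    using assms subD that by (simp add: add_assoc scale_add scale_closed)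
  show ?thesis
  proof (intro subset_antisym subsetI)
    fix z assume "z \<in> vscale (vquotient V U) c (vcoset V U v)"
    then obtain u u' where "u \<in> U" "u' \<in> U" "z = vadd V (vscale V c (vadd V v u)) u'"
      unfolding vquotient_def vcoset_def by auto
    then show "z \<in> vcoset V U (vscale V c v)"
      unfolding vcoset_def using * sub_closed(2,3) by auto
  next
    fix z assume "z \<in> vcoset V U (vscale V c v)"
    then obtain u where "u \<in> U" "z = vadd V (vscale V c (vadd V v (vzero V))) u"
      unfolding vcoset_def using assms add_zero by auto
    then show "z \<in> vscale (vquotient V U) c (vcoset V U v)"
      unfolding vquotient_def vcoset_def using sub_closed(1) by auto
  qed
qed

lemma coset_self: "v \<in> vcarrier V \<Longrightarrow> v \<in> vcoset V U v"
  unfolding vcoset_def using add_zero sub_closed(1) by force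

lemma coset_eq_iff:
  assumes "v \<in> vcarrier V" "w \<in> vcarrier V"
  shows "vcoset V U v = vcoset V U w \<longleftrightarrow> vadd V v (vscale V (- 1) w) \<in> U"
proof
  assume "vcoset V U v = vcoset V U w"
  then obtain u where u: "u \<in> U" "v = vadd V w u"
    using coset_self[OF assms(1)] unfolding vcoset_def by blast
  then have "vadd V v (vscale V (- 1) w) = u"
    using assms subD
    by (metis add_assoc add_commute add_neg add_zero scale_closed)
  then show "vadd V v (vscale V (- 1) w) \<in> U" using u by simp
next
  have sub: "vcoset V U x \<subseteq> vcoset V U y"
    if "vadd V x (vscale V (- 1) y) \<in> U" "x \<in> vcarrier V" "y \<in> vcarrier V" for x y
  proof
    fix z assume "z \<in> vcoset V U x"
    then obtain u where u: "u \<in> U" "z = vadd V x u" unfolding vcoset_def by blast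
    have "vadd V y (vadd V (vadd V x (vscale V (- 1) y)) u) = vadd V y (vadd V (vscale V (- 1) y) z)"
      using u that subD by (simp add: add_assoc add_left_commute add_closed scale_closed)
    also have "\<dots> = z"
      using u that subD
      by (metis add_assoc add_commute add_neg add_zero scale_closed add_closed zero_closed)
    finally show "z \<in> vcoset V U y"
      unfolding vcoset_def using u that sub_closed(2) by blast
  qed
  assume vw: "vadd V v (vscale V (- 1) w) \<in> U"
  \<comment> \<open>Negating the difference exchanges the two representatives, so the inclusion
    \<open>sub\<close> applies in both directions.\<close>
  have "vscale V (- 1) (vadd V v (vscale V (- 1) w)) = vadd V w (vscale V (- 1) v)"
    using assms by (simp add: scale_add scale_scale scale_one scale_closed add_commute)
  then have "vadd V w (vscale V (- 1) v) \<in> U"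
    using sub_closed(3)[OF vw] by metis
  then show "vcoset V U v = vcoset V U w"
    using sub[OF vw] sub assms by blast
qed

lemma coset_zero: "vcoset V U (vzero V) = vzero (vquotient V U)"
proof -
  have "vadd V (vzero V) u = u" if "u \<in> U" for u
    using that subD zero_closed by (metis add_commute add_zero)
  then show ?thesis
    unfolding vcoset_def vquotient_def by force
qed

lemma quotient_carrier: "vcarrier (vquotient V U) = vcoset V U ` vcarrier V"
  by (simp add: vquotient_def)

lemma vspace_on_quotient: "vspace_on (vquotient V U)"
  by unfold_locales
    (auto simp: quotient_carrier coset_zero[symmetric] coset_add coset_scale zero_closed add_closed
      scale_closed add_zero add_neg scale_add add_scale scale_scale scale_one add_assoc
      intro!: imageI, (metis add_commute)+)

end

end

lemma vspace_of_simps: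
  "vcarrier (vspace_of s) = UNIV" "vadd (vspace_of s) = (+)" "vzero (vspace_of s) = 0"
  "vscale (vspace_of s) = s"
  by (simp_all add: vspace_of_def)

lemma (in vector_space) vspace_on_vspace_of: "vspace_on (vspace_of scale)"
  by unfold_locales (simp_all add: vspace_of_def algebra_simps)

lemma (in vector_space) vsubspace_vspace_of: "vsubspace (vspace_of scale) U \<longleftrightarrow> subspace U"
  by (auto simp: vsubspace_def vspace_of_def subspace_def)


section \<open>Tensor products\<close>

lemma lookup_free_scale: "Poly_Mapping.lookup (free_scale c p) i = c * Poly_Mapping.lookup p i"
  unfolding free_scale_def by (simp add: Poly_Mapping.map.rep_eq when_def)

interpretation free: vector_space "free_scale :: 'k::field \<Rightarrow> ('i \<Rightarrow>\<^sub>0 'k) \<Rightarrow> ('i \<Rightarrow>\<^sub>0 'k)"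
  by unfold_locales
    (auto intro!: poly_mapping_eqI simp: lookup_free_scale lookup_add algebra_simps)

definition bilinear_map ::
    "('k::field \<Rightarrow> 'v::ab_group_add \<Rightarrow> 'v) \<Rightarrow> ('k \<Rightarrow> 'w::ab_group_add \<Rightarrow> 'w)
      \<Rightarrow> ('k \<Rightarrow> 'u::ab_group_add \<Rightarrow> 'u) \<Rightarrow> ('v \<Rightarrow> 'w \<Rightarrow> 'u) \<Rightarrow> bool" where
  "bilinear_map s s' r \<beta> \<longleftrightarrow>
     (\<forall>v v' w. \<beta> (v + v') w = \<beta> v w + \<beta> v' w) \<and> (\<forall>v w w'. \<beta> v (w + w') = \<beta> v w + \<beta> v w') \<and>
     (\<forall>c v w. \<beta> (s c v) w = r c (\<beta> v w)) \<and> (\<forall>c v w. \<beta> v (s' c w) = r c (\<beta> v w))"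

text \<open>The linear extension of \<beta> to the free vector space, written exactly as the map
  inside \<open>tensor_lift\<close>, so that unfolding identifies the two.\<close>

definition free_extend ::
    "('k::field \<Rightarrow> 'u::ab_group_add \<Rightarrow> 'u) \<Rightarrow> ('v \<Rightarrow> 'w \<Rightarrow> 'u) \<Rightarrow> ('v \<times> 'w \<Rightarrow>\<^sub>0 'k) \<Rightarrow> 'u" where
  "free_extend r \<beta> p =
     (\<Sum>(v, w)\<in>Poly_Mapping.keys p. r (Poly_Mapping.lookup p (v, w)) (\<beta> v w))"

text \<open>Every element of the tensor product is named by a representative in the free space, and
  computations are carried out on these representatives.\<close>

abbreviation tensor_coset ::
    "('k::field \<Rightarrow> 'v::ab_group_add \<Rightarrow> 'v) \<Rightarrow> ('k \<Rightarrow> 'w::ab_group_add \<Rightarrow> 'w)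
      \<Rightarrow> ('v \<times> 'w \<Rightarrow>\<^sub>0 'k) \<Rightarrow> ('v \<times> 'w \<Rightarrow>\<^sub>0 'k) set" where
  "tensor_coset s s' \<equiv> vcoset (vspace_of free_scale) (bilinear_relations s s')"

lemma subspace_bilinear_relations: "free.subspace (bilinear_relations s s')"
  unfolding bilinear_relations_def by (rule free.subspace_span)

lemma bilinear_relations_gens:
  "free_gen (v + v', w) - free_gen (v, w) - free_gen (v', w) \<in> bilinear_relations s s'"
  "free_gen (v, w + w') - free_gen (v, w) - free_gen (v, w') \<in> bilinear_relations s s'"
  "free_gen (s c v, w) - free_scale c (free_gen (v, w)) \<in> bilinear_relations s s'"
  "free_gen (v, s' c w) - free_scale c (free_gen (v, w)) \<in> bilinear_relations s s'"
  unfolding bilinear_relations_def by (rule free.span_base, blast)+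

lemma vsubspace_bilinear_relations:
  "vsubspace (vspace_of free_scale) (bilinear_relations s s')"
  by (simp add: free.vsubspace_vspace_of subspace_bilinear_relations)

interpretation free_on: vspace_on "vspace_of (free_scale :: 'k::field \<Rightarrow> ('i \<Rightarrow>\<^sub>0 'k) \<Rightarrow> ('i \<Rightarrow>\<^sub>0 'k))"
  by (rule free.vspace_on_vspace_of)

lemma vspace_on_tensor_space: "vspace_on (tensor_space s s')"
  unfolding tensor_space_def
  by (rule free_on.vspace_on_quotient[OF vsubspace_bilinear_relations])

lemma tensor_space_carrier: "vcarrier (tensor_space s s') = range (tensor_coset s s')"
  by (simp add: tensor_space_def vquotient_def vspace_of_simps)

lemma tensor_coset_add:
  "vadd (tensor_space s s') (tensor_coset s s' p) (tensor_coset s s' p') = tensor_coset s s' (p + p')"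
  unfolding tensor_space_def
  by (subst free_on.coset_add[OF vsubspace_bilinear_relations]) (simp_all add: vspace_of_simps)

lemma tensor_coset_scale:
  "vscale (tensor_space s s') c (tensor_coset s s' p) = tensor_coset s s' (free_scale c p)"
  unfolding tensor_space_def
  by (subst free_on.coset_scale[OF vsubspace_bilinear_relations]) (simp_all add: vspace_of_simps)

lemma tensor_coset_zero: "tensor_coset s s' 0 = vzero (tensor_space s s')"
  using free_on.coset_zero[OF vsubspace_bilinear_relations]
  by (simp add: tensor_space_def vspace_of_simps)

lemma tensor_coset_relation:
  "p \<in> bilinear_relations s s' \<Longrightarrow> tensor_coset s s' p = vzero (tensor_space s s')"
  using free_on.coset_eq_iff[OF vsubspace_bilinear_relations, of p 0 s s']
  by (simp add: vspace_of_simps tensor_coset_zero)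

section \<open>Linear maps induced on the tensor product\<close>

context vector_space
begin

text \<open>Sums and multiples may have cancelling coefficients and hence fewer keys. Summing over a
  common finite superset adds only zero terms and makes linearity a termwise matter.\<close>

lemma free_extend_superset:
  assumes "finite K" "Poly_Mapping.keys p \<subseteq> K"
  shows "free_extend scale \<beta> p = (\<Sum>(v, w)\<in>K. scale (Poly_Mapping.lookup p (v, w)) (\<beta> v w))"
  unfolding free_extend_def using assms
  by (intro sum.mono_neutral_left) (auto simp: in_keys_iff)

lemma free_extend_linear: "Vector_Spaces.linear free_scale scale (free_extend scale \<beta>)"
  unfolding Vector_Spaces.linear_iff
proof (intro conjI allI)
  fix p q :: "'c \<times> 'd \<Rightarrow>\<^sub>0 'a" and c :: 'a
  let ?K = "Poly_Mapping.keys p \<union> Poly_Mapping.keys q"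
  have K: "finite ?K" by simp
  show "free_extend scale \<beta> (p + q) = free_extend scale \<beta> p + free_extend scale \<beta> q"
    using keys_add[of p q]
    by (simp add: free_extend_superset[OF K] sum.distrib[symmetric] lookup_add
        scale_left_distrib split_beta)
  have "Poly_Mapping.keys (free_scale c p) \<subseteq> Poly_Mapping.keys p"
    by (auto simp: in_keys_iff lookup_free_scale)
  then show "free_extend scale \<beta> (free_scale c p) = scale c (free_extend scale \<beta> p)"
    by (simp add: free_extend_superset[of "Poly_Mapping.keys p"] scale_sum_right lookup_free_scale
        split_beta)
qed (fact free.vector_space_axioms vector_space_axioms)+

lemma free_extend_add: "free_extend scale \<beta> (p + q) = free_extend scale \<beta> p + free_extend scale \<beta> q"
  and free_extend_scale: "free_extend scale \<beta> (free_scale c p) = scale c (free_extend scale \<beta> p)"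
  using free_extend_linear[of \<beta>] unfolding Vector_Spaces.linear_iff by blast+

lemma free_extend_zero [simp]: "free_extend scale \<beta> 0 = 0"
  by (simp add: free_extend_def)

lemma free_extend_diff: "free_extend scale \<beta> (p - q) = free_extend scale \<beta> p - free_extend scale \<beta> q"
  using free_extend_add[of \<beta> "p - q" q] by simp

lemma free_extend_gen [simp]: "free_extend scale \<beta> (free_gen (v, w)) = \<beta> v w"
  by (simp add: free_extend_def)

lemma free_extend_relation:
  assumes "bilinear_map s s' scale \<beta>" "p \<in> bilinear_relations s s'"
  shows "free_extend scale \<beta> p = 0"
proof -
  have sub: "free.subspace {p. free_extend scale \<beta> p = 0}"
    by (simp add: free.subspace_def free_extend_add free_extend_scale)
  have "bilinear_relations s s' \<subseteq> {p. free_extend scale \<beta> p = 0}"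
    unfolding bilinear_relations_def using assms(1) sub
    by (intro free.span_minimal)
      (auto simp: bilinear_map_def free_extend_diff free_extend_scale)
  then show ?thesis using assms(2) by blast
qed

text \<open>Bilinearity makes the linear extension constant on each coset, so the image inside
  \<open>tensor_lift\<close> is a singleton and \<open>the_elem\<close> returns the expected
  value.\<close>

lemma tensor_lift_coset:
  assumes "bilinear_map s s' scale \<beta>"
  shows "tensor_lift scale \<beta> (tensor_coset s s' p) = free_extend scale \<beta> p"
proof -
  have "free_extend scale \<beta> p' = free_extend scale \<beta> p" if "p' \<in> tensor_coset s s' p" for p'
    using that free_extend_relation[OF assms]
    by (auto simp: vcoset_def vspace_of_simps free_extend_add)
  moreover have "p \<in> tensor_coset s s' p"
    by (rule free_on.coset_self[OF vsubspace_bilinear_relations]) (simp add: vspace_of_simps)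
  ultimately have "free_extend scale \<beta> ` tensor_coset s s' p = {free_extend scale \<beta> p}"
    by blast
  then show ?thesis
    by (simp add: tensor_lift_def free_extend_def[abs_def])
qed

end


section \<open>Hochschild homology\<close>

text \<open>These are the functionals on all of B \<otimes> B that vanish on boundaries; a
  functional on HH1 is given on cycles only.\<close>

definition hochschild_cocycle ::
    "('k::field \<Rightarrow> 'b::{ring,monoid_mult} \<Rightarrow> 'b) \<Rightarrow> ('b \<Rightarrow> 'b \<Rightarrow> 'k) \<Rightarrow> bool" where
  "hochschild_cocycle scale \<Phi> \<longleftrightarrow> bilinear_map scale scale (*) \<Phi> \<and>
     (\<forall>x y z. \<Phi> (x * y) z - \<Phi> x (y * z) + \<Phi> (z * x) y = 0)"

text \<open>A derivation kills 1: put y = z = 1 in the cocycle identity.\<close>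

lemma hochschild_cocycle_one:
  assumes "hochschild_cocycle scale \<Phi>"
  shows "\<Phi> x 1 = 0"
proof -
  have "\<Phi> (x * 1) 1 - \<Phi> x (1 * 1) + \<Phi> (1 * x) 1 = 0"
    using assms unfolding hochschild_cocycle_def by blast
  then show ?thesis by simp
qed

section \<open>Cycles and boundaries in B \<otimes> B\<close>

context algebra_over_field
begin

abbreviation "BB \<equiv> tensor_space scale scale"
abbreviation "cls \<equiv> tensor_coset scale scale"
abbreviation "commutator_ext \<equiv> free_extend scale (\<lambda>x y. x * y - y * x)"
abbreviation "bd x y z \<equiv> free_gen (x * y, z) - free_gen (x, y * z) + free_gen (z * x, y)"

lemma bilinear_commutator: "bilinear_map scale scale scale (\<lambda>x y. x * y - y * x)"
  by (simp add: bilinear_map_def scale_mult_left scale_mult_right algebra_simps)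

lemma HH1_cycles_eq: "HH1_cycles scale = cls ` {p. commutator_ext p = 0}"
  unfolding HH1_cycles_def tensor_space_carrier
  by (auto simp: tensor_lift_coset[OF bilinear_commutator])

lemma HH1_cycles_iff: "cls p \<in> HH1_cycles scale \<longleftrightarrow> commutator_ext p = 0"
  by (simp add: HH1_cycles_def tensor_space_carrier tensor_lift_coset[OF bilinear_commutator])

lemma vsubspace_cycles: "vsubspace BB (HH1_cycles scale)"
  unfolding vsubspace_def HH1_cycles_eq
proof (intro conjI ballI allI)
  show "vzero BB \<in> cls ` {p. commutator_ext p = 0}"
    by (auto simp: tensor_coset_zero[symmetric])
qed (auto simp: tensor_space_carrier tensor_coset_add tensor_coset_scale
      free_extend_add free_extend_scale intro!: imageI)

lemma HH1_boundaries_eq: "HH1_boundaries scale = vspan BB {cls (bd x y z) | x y z. True}"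
  by (simp add: HH1_boundaries_def Let_def tensor_def tensor_coset_add tensor_coset_scale)

lemma bd_cycle: "commutator_ext (bd x y z) = 0"
  by (simp add: free_extend_add free_extend_diff algebra_simps)

lemma vsubspace_boundaries_tensor: "vsubspace BB (HH1_boundaries scale)"
  unfolding HH1_boundaries_eq
  by (rule vspace_on.subspace_vspan[OF vspace_on_tensor_space]) (auto simp: tensor_space_carrier)

lemma boundaries_subset_cycles: "HH1_boundaries scale \<subseteq> HH1_cycles scale"
  unfolding HH1_boundaries_eq
  by (rule vspace_on.vspan_minimal[OF vspace_on_tensor_space vsubspace_cycles])
    (auto simp: HH1_cycles_iff bd_cycle)

lemma bd_in_boundaries: "cls (bd x y z) \<in> HH1_boundaries scale"
  unfolding HH1_boundaries_eq
  by (rule subsetD[OF vspace_on.vspan_superset[OF vspace_on_tensor_space]]) blast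

lemma boundaries_closed:
  assumes "cls p \<in> HH1_boundaries scale" "cls q \<in> HH1_boundaries scale"
  shows "cls (p + q) \<in> HH1_boundaries scale" "cls (free_scale c p) \<in> HH1_boundaries scale"
    "cls (p - q) \<in> HH1_boundaries scale"
proof -
  have add: "cls (p + q) \<in> HH1_boundaries scale"
    if "cls p \<in> HH1_boundaries scale" "cls q \<in> HH1_boundaries scale" for p q
    using vsubspace_boundaries_tensor that
    by (simp add: vsubspace_def tensor_coset_add[symmetric])
  have scl: "cls (free_scale c p) \<in> HH1_boundaries scale"
    if "cls p \<in> HH1_boundaries scale" for c p
    using vsubspace_boundaries_tensor that
    by (simp add: vsubspace_def tensor_coset_scale[symmetric])
  show "cls (p - q) \<in> HH1_boundaries scale"
    using add[OF assms(1) scl[OF assms(2), of "- 1"]] by simp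
  show "cls (p + q) \<in> HH1_boundaries scale" "cls (free_scale c p) \<in> HH1_boundaries scale"
    using assms add scl by blast+
qed

section \<open>Degree-one homology as a quotient of the cycles\<close>

sublocale cycles: vspace_on "HH1_cycle_space scale"
  unfolding HH1_cycle_space_def
  by (rule vspace_on.vspace_on_subspace[OF vspace_on_tensor_space vsubspace_cycles])

lemma vsubspace_boundaries: "vsubspace (HH1_cycle_space scale) (HH1_boundaries scale)"
  using vsubspace_boundaries_tensor boundaries_subset_cycles
  by (auto simp: vsubspace_def HH1_cycle_space_def)

lemma HH1_carrier: "vcarrier (HH1 scale) = (HH1_class scale \<circ> cls) ` {p. commutator_ext p = 0}"
  by (simp add: HH1_def vquotient_def HH1_cycle_space_def HH1_class_def[abs_def] HH1_cycles_eq
      image_comp comp_def)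

lemma HH1_class_add:
  assumes "commutator_ext p = 0" "commutator_ext q = 0"
  shows "vadd (HH1 scale) (HH1_class scale (cls p)) (HH1_class scale (cls q)) =
    HH1_class scale (cls (p + q))"
  using cycles.coset_add[OF vsubspace_boundaries, of "cls p" "cls q"] assms
  by (simp add: HH1_def HH1_class_def HH1_cycle_space_def HH1_cycles_iff tensor_coset_add)

lemma HH1_class_scale:
  assumes "commutator_ext p = 0"
  shows "vscale (HH1 scale) c (HH1_class scale (cls p)) = HH1_class scale (cls (free_scale c p))"
  using cycles.coset_scale[OF vsubspace_boundaries, of "cls p" c] assms
  by (simp add: HH1_def HH1_class_def HH1_cycle_space_def HH1_cycles_iff tensor_coset_scale)

lemma HH1_class_eq_iff:
  assumes "commutator_ext p = 0" "commutator_ext q = 0"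
  shows "HH1_class scale (cls p) = HH1_class scale (cls q) \<longleftrightarrow> cls (p - q) \<in> HH1_boundaries scale"
  using cycles.coset_eq_iff[OF vsubspace_boundaries, of "cls p" "cls q"] assms
  by (simp add: HH1_class_def HH1_cycle_space_def HH1_cycles_iff tensor_coset_add tensor_coset_scale)

lemma cls_bilinear:
  shows "cls (free_gen (v + v', w)) = cls (free_gen (v, w) + free_gen (v', w))"
    and "cls (free_gen (v, w + w')) = cls (free_gen (v, w) + free_gen (v, w'))"
    and "cls (free_gen (scale c v, w)) = cls (free_scale c (free_gen (v, w)))"
    and "cls (free_gen (v, scale c w)) = cls (free_scale c (free_gen (v, w)))"
proof -
  have eqI: "cls p = cls q" if "p - q \<in> bilinear_relations scale scale" for p q
    using free_on.coset_eq_iff[OF vsubspace_bilinear_relations, of p q scale scale] that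
    by (simp add: vspace_of_simps)
  show "cls (free_gen (v + v', w)) = cls (free_gen (v, w) + free_gen (v', w))"
    "cls (free_gen (v, w + w')) = cls (free_gen (v, w) + free_gen (v, w'))"
    "cls (free_gen (scale c v, w)) = cls (free_scale c (free_gen (v, w)))"
    "cls (free_gen (v, scale c w)) = cls (free_scale c (free_gen (v, w)))"
    by (rule eqI, simp only: bilinear_relations_gens diff_diff_eq[symmetric])+
qed

section \<open>The Connes boundary on representatives\<close>

abbreviation "connes_rep x \<equiv> free_gen (1, x) + free_gen (x, 1)"

lemma connes_rep_cycle: "commutator_ext (connes_rep x) = 0"
  by (simp add: free_extend_add)

text \<open>In the free space \<open>connes_rep\<close> is not linear in x; linearity holds only
  modulo the bilinear relations. The class is therefore split into summands, rewritten there, and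
  merged again.\<close>

lemma cls_connes_rep:
  "cls (connes_rep (x + y)) = cls (connes_rep x + connes_rep y)"
  "cls (connes_rep (scale c x)) = cls (free_scale c (connes_rep x))"
proof -
  show "cls (connes_rep (x + y)) = cls (connes_rep x + connes_rep y)"
    by (simp add: tensor_coset_add[symmetric] cls_bilinear)
      (simp add: tensor_coset_add ac_simps)
  show "cls (connes_rep (scale c x)) = cls (free_scale c (connes_rep x))"
    by (simp add: tensor_coset_add[symmetric] cls_bilinear)
      (simp add: tensor_coset_add free.scale_right_distrib)
qed

text \<open>This is what makes the Connes boundary well defined on HH0. Each of the two summands of
  the representative of a commutator is a boundary by itself.\<close>

lemma connes_rep_commutator:
  assumes "c \<in> commutator_space scale"
  shows "cls (connes_rep c) \<in> HH1_boundaries scale"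
proof -
  have right_one: "cls (free_gen (x, 1)) \<in> HH1_boundaries scale" for x
    using bd_in_boundaries[of x 1 1] by simp
  have left_one: "cls (free_gen (1, x * y - y * x)) \<in> HH1_boundaries scale" for x y
  proof -
    \<comment> \<open>In both boundaries the terms x \<otimes> y and y \<otimes> x occur with the
      same sign. They cancel in the difference and leave 1 \<otimes> xy - 1 \<otimes> yx.\<close>
    have "cls (bd 1 y x - bd 1 x y) \<in> HH1_boundaries scale"
      by (intro boundaries_closed bd_in_boundaries)
    moreover have "bd 1 y x - bd 1 x y = free_gen (1, x * y) + free_scale (- 1) (free_gen (1, y * x))"
      by simp
    moreover have "cls (free_gen (1, x * y - y * x)) =
        cls (free_gen (1, x * y) + free_scale (- 1) (free_gen (1, y * x)))"
      using cls_bilinear(2)[of 1 "x * y" "scale (- 1) (y * x)"] cls_bilinear(4)[of 1 "- 1" "y * x"]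
      by (simp only: tensor_coset_add[symmetric]) simp
    ultimately show ?thesis by metis
  qed
  have "subspace {c. cls (connes_rep c) \<in> HH1_boundaries scale}"
    unfolding subspace_def
  proof (intro conjI ballI allI)
    \<comment> \<open>The representative of 0 need not be zero in the free space; its class is zero
      because 0 is a zero multiple of itself.\<close>
    have "cls (connes_rep 0) = cls (free_scale 0 (connes_rep 0))"
      using cls_connes_rep(2)[of 0 0] by simp
    then show "0 \<in> {c. cls (connes_rep c) \<in> HH1_boundaries scale}"
      using boundaries_closed(2)[OF right_one right_one, of 0] by (simp add: free.scale_zero_left)
  qed (simp_all add: cls_connes_rep boundaries_closed)
  then have "commutator_space scale \<subseteq> {c. cls (connes_rep c) \<in> HH1_boundaries scale}"
    unfolding commutator_space_def
    by (intro span_minimal) (auto intro!: boundaries_closed left_one right_one)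
  then show ?thesis using assms by blast
qed

text \<open>Two members of a class in HH0 differ by a commutator-space element, whose Connes
  representative is a boundary; so \<open>the_elem\<close> is applied to a singleton.\<close>

lemma connes_boundary_class:
  "connes_boundary scale (HH0_class scale x) = HH1_class scale (cls (connes_rep x))"
proof -
  have "HH1_class scale (cls (connes_rep y)) = HH1_class scale (cls (connes_rep x))"
    if y: "y \<in> HH0_class scale x" for y
  proof -
    obtain c where c: "c \<in> commutator_space scale" "y = x + c"
      using y by (auto simp: HH0_class_def vcoset_def vspace_of_simps)
    have "HH1_class scale (cls (connes_rep y)) = HH1_class scale (cls (connes_rep x + connes_rep c))"
      using c(2) cls_connes_rep(1) by metis
    also have "\<dots> = HH1_class scale (cls (connes_rep x))"
      using connes_rep_commutator[OF c(1)] connes_rep_cycle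
      by (subst HH1_class_eq_iff) (simp_all add: free_extend_add[of _ "connes_rep x"])
    finally show ?thesis .
  qed
  moreover have "x \<in> HH0_class scale x"
    unfolding HH0_class_def commutator_space_def
    by (rule vspace_on.coset_self[OF vspace_on_vspace_of])
      (simp_all add: vsubspace_vspace_of, simp add: vspace_of_simps)
  ultimately have "(\<lambda>x. HH1_class scale (cls (connes_rep x))) ` HH0_class scale x =
      {HH1_class scale (cls (connes_rep x))}"
    by blast
  then show ?thesis
    by (simp add: connes_boundary_def tensor_def tensor_coset_add)
qed

section \<open>Functionals on HH1 and cocycles\<close>

lemma cocycle_imp_HH1_functional:
  assumes "hochschild_cocycle scale \<Phi>"
  shows "\<exists>\<phi>\<in>vdual (HH1 scale). \<forall>p. commutator_ext p = 0 \<longrightarrow>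
           \<phi> (HH1_class scale (cls p)) = free_extend (*) \<Phi> p"
proof -
  interpret field: vector_space "(*) :: 'k \<Rightarrow> 'k \<Rightarrow> 'k" by (rule vector_space_field)
  have bil: "bilinear_map scale scale (*) \<Phi>"
    and coc: "\<Phi> (x * y) z - \<Phi> x (y * z) + \<Phi> (z * x) y = 0" for x y z
    using assms unfolding hochschild_cocycle_def by blast+
  define L where "L = tensor_lift (*) \<Phi>"
  have L: "L (cls p) = free_extend (*) \<Phi> p" for p
    unfolding L_def by (rule field.tensor_lift_coset[OF bil])
  have "vsubspace BB {t \<in> vcarrier BB. L t = 0}"
    unfolding vsubspace_def
  proof (intro conjI ballI allI)
    show "vzero BB \<in> {t \<in> vcarrier BB. L t = 0}"
      by (simp add: tensor_coset_zero[symmetric] tensor_space_carrier L)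
  qed (auto simp: tensor_space_carrier tensor_coset_add tensor_coset_scale L
        field.free_extend_add field.free_extend_scale)
  then have "HH1_boundaries scale \<subseteq> {t \<in> vcarrier BB. L t = 0}"
    unfolding HH1_boundaries_eq
    by (rule vspace_on.vspan_minimal[OF vspace_on_tensor_space])
      (auto simp: tensor_space_carrier L field.free_extend_add field.free_extend_diff coc)
  then have bdry: "L t = 0" if "t \<in> HH1_boundaries scale" for t
    using that by blast
  \<comment> \<open>Any choice of cycle in a class gives the same value, since two of them differ by
    a boundary and L vanishes on boundaries.\<close>
  define \<phi> where "\<phi> C = L (SOME t. t \<in> C)" for C
  have \<phi>: "\<phi> (HH1_class scale (cls p)) = free_extend (*) \<Phi> p" if p: "commutator_ext p = 0" for p
  proof -
    have "cls p \<in> HH1_class scale (cls p)"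
      unfolding HH1_class_def
      by (rule cycles.coset_self[OF vsubspace_boundaries])
        (simp add: HH1_cycle_space_def HH1_cycles_iff p)
    then have "(SOME t. t \<in> HH1_class scale (cls p)) \<in> HH1_class scale (cls p)"
      by (rule someI)
    then obtain u where u: "u \<in> HH1_boundaries scale"
        "(SOME t. t \<in> HH1_class scale (cls p)) = vadd BB (cls p) u"
      by (auto simp: HH1_class_def vcoset_def HH1_cycle_space_def)
    then obtain q where q: "u = cls q"
      using boundaries_subset_cycles HH1_cycles_eq by blast
    have "\<phi> (HH1_class scale (cls p)) = L (cls p) + L (cls q)"
      unfolding \<phi>_def u(2) q by (simp add: tensor_coset_add L field.free_extend_add)
    then show ?thesis
      using bdry[OF u(1)] by (simp add: q L)
  qed
  have "\<phi> \<in> vdual (HH1 scale)"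
    unfolding vdual_def vlinear_def
    by (auto simp: HH1_carrier HH1_class_add HH1_class_scale \<phi> vspace_of_simps free_extend_add
        free_extend_scale field.free_extend_add field.free_extend_scale)
  with \<phi> show ?thesis by blast
qed

lemma HH1_functional_imp_cocycle:
  assumes "\<phi> \<in> vdual (HH1 scale)"
  shows "\<exists>\<Phi>. hochschild_cocycle scale \<Phi> \<and>
           (\<forall>x. \<phi> (HH1_class scale (cls (connes_rep x))) = \<Phi> 1 x + \<Phi> x 1)"
proof -
  \<comment> \<open>Cycles are lifted to the free space, where they include the bilinear relations.
    The functional is extended there, and bilinearity of the result has to be recovered
    afterwards.\<close>
  define Z where "Z = {p. commutator_ext p = 0}"
  define \<Psi> where "\<Psi> p = \<phi> (HH1_class scale (cls p))" for p
  have \<Psi>_add: "\<Psi> (p + q) = \<Psi> p + \<Psi> q" if "p \<in> Z" "q \<in> Z" for p q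
    using assms that
    by (auto simp: vdual_def vlinear_def \<Psi>_def Z_def HH1_carrier vspace_of_simps HH1_class_add[symmetric])
  have \<Psi>_scale: "\<Psi> (free_scale c p) = c * \<Psi> p" if "p \<in> Z" for p c
    using assms that
    by (auto simp: vdual_def vlinear_def \<Psi>_def Z_def HH1_carrier vspace_of_simps HH1_class_scale[symmetric])
  have subZ: "free.subspace Z"
    by (simp add: Z_def free.subspace_def free_extend_add free_extend_scale)
  obtain \<pi> where \<pi>: "\<And>p. \<pi> p \<in> Z" "Vector_Spaces.linear free_scale free_scale \<pi>"
      "\<And>p. p \<in> Z \<Longrightarrow> \<pi> p = p"
    using free.exists_projection[OF subZ] by blast
  define \<Psi>' where "\<Psi>' p = \<Psi> (\<pi> p)" for p
  have add: "\<Psi>' (p + q) = \<Psi>' p + \<Psi>' q" and scl: "\<Psi>' (free_scale c p) = c * \<Psi>' p" for p q c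
    using \<pi>(1,2) \<Psi>_add \<Psi>_scale by (simp_all add: \<Psi>'_def Vector_Spaces.linear_iff)
  have diff: "\<Psi>' (p - q) = \<Psi>' p - \<Psi>' q" for p q
    using add[of "p - q" q] by simp
  have \<Psi>_0: "\<Psi> 0 = 0"
    using \<Psi>_scale[of 0 0] by (simp add: Z_def)
  have bdry: "\<Psi>' p = 0" if "p \<in> Z" "cls p \<in> HH1_boundaries scale" for p
  proof -
    have "HH1_class scale (cls p) = HH1_class scale (cls 0)"
      using that by (subst HH1_class_eq_iff) (simp_all add: Z_def)
    then show ?thesis
      using that \<pi>(3) \<Psi>_0 by (simp add: \<Psi>'_def \<Psi>_def)
  qed
  \<comment> \<open>A bilinear relation is a cycle with zero class in the tensor product, hence
    represents a boundary; the extension thus descends to B \<otimes> B.\<close>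
  have rel: "\<Psi>' p = 0" if "p \<in> bilinear_relations scale scale" for p
  proof (rule bdry)
    show "p \<in> Z"
      unfolding Z_def using free_extend_relation[OF bilinear_commutator that] by simp
    show "cls p \<in> HH1_boundaries scale"
      using tensor_coset_relation[OF that] vsubspace_boundaries_tensor
      by (simp add: vsubspace_def)
  qed
  define \<Phi> where "\<Phi> x y = \<Psi>' (free_gen (x, y))" for x y
  have "bilinear_map scale scale (*) \<Phi>"
    unfolding bilinear_map_def
  proof (intro conjI allI)
    fix v v' w w' :: 'b and c :: 'k
    have "\<Psi>' (free_gen (v + v', w) - free_gen (v, w) - free_gen (v', w)) = 0"
      "\<Psi>' (free_gen (v, w + w') - free_gen (v, w) - free_gen (v, w')) = 0"
      "\<Psi>' (free_gen (scale c v, w) - free_scale c (free_gen (v, w))) = 0"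
      "\<Psi>' (free_gen (v, scale c w) - free_scale c (free_gen (v, w))) = 0"
      by (rule rel, rule bilinear_relations_gens)+
    then show "\<Phi> (v + v') w = \<Phi> v w + \<Phi> v' w" "\<Phi> v (w + w') = \<Phi> v w + \<Phi> v w'"
      "\<Phi> (scale c v) w = c * \<Phi> v w" "\<Phi> v (scale c w) = c * \<Phi> v w"
      by (simp_all add: \<Phi>_def diff scl diff_eq_eq add.commute)
  qed
  moreover have "\<Phi> (x * y) z - \<Phi> x (y * z) + \<Phi> (z * x) y = 0" for x y z
    using bdry[of "bd x y z"] bd_cycle bd_in_boundaries by (simp add: Z_def \<Phi>_def diff add)
  moreover have "\<phi> (HH1_class scale (cls (connes_rep x))) = \<Phi> 1 x + \<Phi> x 1" for x
  proof -
    have "\<phi> (HH1_class scale (cls (connes_rep x))) = \<Psi>' (connes_rep x)"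
      using \<pi>(3)[of "connes_rep x"] connes_rep_cycle[of x] by (simp add: \<Psi>'_def \<Psi>_def Z_def)
    then show ?thesis by (simp add: add \<Phi>_def)
  qed
  ultimately show ?thesis
    unfolding hochschild_cocycle_def by blast
qed

lemma connes_transpose_image_iff:
  "\<tau> \<in> HH0_dual_pullback scale ` (connes_transpose scale ` vdual (HH1 scale)) \<longleftrightarrow>
     (\<exists>\<Phi>. hochschild_cocycle scale \<Phi> \<and> \<tau> = \<Phi> 1)"
proof
  assume "\<tau> \<in> HH0_dual_pullback scale ` (connes_transpose scale ` vdual (HH1 scale))"
  then obtain \<phi> where \<phi>: "\<phi> \<in> vdual (HH1 scale)"
      and \<tau>: "\<tau> = HH0_dual_pullback scale (connes_transpose scale \<phi>)"
    by blast
  obtain \<Phi> where \<Phi>: "hochschild_cocycle scale \<Phi>"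
      "\<And>x. \<phi> (HH1_class scale (cls (connes_rep x))) = \<Phi> 1 x + \<Phi> x 1"
    using HH1_functional_imp_cocycle[OF \<phi>] by blast
  have "\<tau> = \<Phi> 1"
    using \<Phi>(2) hochschild_cocycle_one[OF \<Phi>(1)]
    by (simp add: fun_eq_iff \<tau> HH0_dual_pullback_def connes_transpose_def connes_boundary_class)
  with \<Phi>(1) show "\<exists>\<Phi>. hochschild_cocycle scale \<Phi> \<and> \<tau> = \<Phi> 1" by blast
next
  interpret field: vector_space "(*) :: 'k \<Rightarrow> 'k \<Rightarrow> 'k" by (rule vector_space_field)
  assume "\<exists>\<Phi>. hochschild_cocycle scale \<Phi> \<and> \<tau> = \<Phi> 1"
  then obtain \<Phi> where \<Phi>: "hochschild_cocycle scale \<Phi>" "\<tau> = \<Phi> 1" by blast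
  obtain \<phi> where \<phi>: "\<phi> \<in> vdual (HH1 scale)"
      "\<And>p. commutator_ext p = 0 \<Longrightarrow> \<phi> (HH1_class scale (cls p)) = free_extend (*) \<Phi> p"
    using cocycle_imp_HH1_functional[OF \<Phi>(1)] by blast
  have "HH0_dual_pullback scale (connes_transpose scale \<phi>) = \<tau>"
    using hochschild_cocycle_one[OF \<Phi>(1)]
    by (simp add: fun_eq_iff \<Phi>(2) HH0_dual_pullback_def connes_transpose_def connes_boundary_class
        \<phi>(2) connes_rep_cycle field.free_extend_add)
  with \<phi>(1) show "\<tau> \<in> HH0_dual_pullback scale ` (connes_transpose scale ` vdual (HH1 scale))"
    by blast
qed


section \<open>Automorphisms of the trivial extension\<close>

abbreviation "triv \<equiv> trivial_extension scale"

lemma triv_simps: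
  "vcarrier triv = UNIV \<times> linear_dual scale"
  "vadd triv (x, f) (y, g) = (x + y, \<lambda>b. f b + g b)"
  "vscale triv c (x, f) = (scale c x, \<lambda>b. c * f b)"
  "amult triv (x, f) (y, g) = (x * y, \<lambda>b. g (b * x) + f (y * b))"
  "aone triv = (1, \<lambda>b. 0)"
  by (simp_all add: trivial_extension_def dual_lmult_def dual_rmult_def)

lemma zero_dual: "(\<lambda>b. 0) \<in> linear_dual scale"
  by (simp add: linear_dual_iff)

text \<open>Pairing with elements (z, 0) determines the functional, and pairing with elements (0, h)
  determines the component in B because functionals separate points.\<close>

lemma canonical_form_nondegenerate:
  assumes "a \<in> vcarrier triv" "b \<in> vcarrier triv"
    and eq: "\<And>c. c \<in> vcarrier triv \<Longrightarrow> canonical_form a c = canonical_form b c"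
  shows "a = b"
proof -
  obtain x f y g where ab: "a = (x, f)" "b = (y, g)" and fg: "f \<in> linear_dual scale" "g \<in> linear_dual scale"
    using assms(1,2) by (auto simp: triv_simps)
  have "f z = g z" for z
    using eq[of "(z, \<lambda>b. 0)"] zero_dual by (simp add: ab triv_simps)
  moreover have "x = y"
  proof (rule linear_dual_separates)
    fix h assume "h \<in> linear_dual scale"
    then show "h x = h y"
      using eq[of "(0, h)"] fg by (simp add: ab triv_simps linear_dual_zero)
  qed
  ultimately show ?thesis by (auto simp: ab)
qed

text \<open>The form comes from the trace (x, f) \<mapsto> f(1) on A. An automorphism can therefore
  be moved out of a pairing of images onto a single product.\<close>

lemma canonical_form_eq_trace: "canonical_form a b = snd (amult triv a b) 1"
  by (cases a; cases b) (simp add: triv_simps)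

lemma canonical_form_assoc: "canonical_form (amult triv a b) c = canonical_form a (amult triv b c)"
  by (cases a; cases b; cases c) (simp add: triv_simps algebra_simps)

lemma canonical_form_commute: "canonical_form a b = canonical_form b a"
  by (cases a; cases b) (simp add: algebra_simps)

lemma amult_closed:
  assumes "a \<in> vcarrier triv" "b \<in> vcarrier triv"
  shows "amult triv a b \<in> vcarrier triv"
  using assms
  by (auto simp: triv_simps linear_dual_iff algebra_simps scale_mult_left scale_mult_right)

text \<open>For uniqueness, put a = 1 in the defining identity: two candidates then have the same
  pairing with every element.\<close>

lemma nakayama_jacobian_eqI:
  assumes "j \<in> vcarrier triv"
    and "\<And>a b. a \<in> vcarrier triv \<Longrightarrow> b \<in> vcarrier triv \<Longrightarrow>
           canonical_form (u a) (u b) = canonical_form (amult triv j a) b"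
  shows "nakayama_jacobian triv canonical_form u = j"
  unfolding nakayama_jacobian_def
proof (rule the_equality)
  fix i
  assume i: "i \<in> vcarrier triv \<and> (\<forall>a\<in>vcarrier triv. \<forall>b\<in>vcarrier triv.
    canonical_form (u a) (u b) = canonical_form (amult triv i a) b)"
  have one: "aone triv \<in> vcarrier triv" "amult triv k (aone triv) = k"
    if "k \<in> vcarrier triv" for k
  proof -
    obtain x f where k: "k = (x, f)" "f \<in> linear_dual scale"
      using \<open>k \<in> vcarrier triv\<close> by (auto simp: triv_simps)
    then show "aone triv \<in> vcarrier triv" "amult triv k (aone triv) = k"
      using zero_dual by (simp_all add: triv_simps)
  qed
  show "i = j"
  proof (rule canonical_form_nondegenerate)
    fix c assume "c \<in> vcarrier triv"
    then show "canonical_form i c = canonical_form j c"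
      using i assms one by metis
  qed (use i assms in auto)
qed (use assms in auto)

section \<open>Automorphisms from central units and cocycles\<close>

lemma central_unit_cocycle_imp_jacobian:
  assumes t: "central_unit t" and \<Phi>: "hochschild_cocycle scale \<Phi>"
  shows "\<exists>u. algebra_automorphism triv u \<and> (t, \<Phi> 1) = nakayama_jacobian triv canonical_form u"
proof -
  obtain s where s: "t * s = 1" "s * t = 1" and comm: "\<And>x. t * x = x * t"
    using t unfolding central_unit_def by blast
  have bil: "\<Phi> (v + v') w = \<Phi> v w + \<Phi> v' w" "\<Phi> v (w + w') = \<Phi> v w + \<Phi> v w'"
    "\<Phi> (scale c v) w = c * \<Phi> v w" "\<Phi> v (scale c w) = c * \<Phi> v w" for v v' w w' c
    using \<Phi> unfolding hochschild_cocycle_def bilinear_map_def by blast+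
  have coc: "\<Phi> x (y * z) = \<Phi> (x * y) z + \<Phi> (z * x) y" for x y z
  proof -
    have "\<Phi> (x * y) z - \<Phi> x (y * z) + \<Phi> (z * x) y = 0"
      using \<Phi> unfolding hochschild_cocycle_def by blast
    then show ?thesis by (simp add: algebra_simps)
  qed
  \<comment> \<open>The derivation shears B into D(B), and t rescales D(B). The inverse v undoes the
    shear and then acts by s, which is why s also occurs inside \<Phi>.\<close>
  define u where "u = (\<lambda>(x, f). (x, \<lambda>b. \<Phi> b x + f (b * t)))"
  define v where "v = (\<lambda>(x, f). (x, \<lambda>b. f (b * s) - \<Phi> (b * s) x))"
  have u: "u (x, f) = (x, \<lambda>b. \<Phi> b x + f (b * t))" for x f
    by (simp add: u_def)
  have u_closed: "u a \<in> vcarrier triv" if "a \<in> vcarrier triv" for a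
    using that
    by (auto simp: u triv_simps linear_dual_iff bil algebra_simps scale_mult_left)
  have "bij_betw u (vcarrier triv) (vcarrier triv)"
  proof (rule bij_betw_byWitness[where f' = v])
    show "\<forall>a\<in>vcarrier triv. v (u a) = a" "\<forall>a\<in>vcarrier triv. u (v a) = a"
      by (auto simp: u_def v_def mult.assoc s)
    show "u ` vcarrier triv \<subseteq> vcarrier triv" using u_closed by blast
    show "v ` vcarrier triv \<subseteq> vcarrier triv"
      by (auto simp: v_def triv_simps linear_dual_iff bil algebra_simps scale_mult_left)
  qed
  moreover have "vlinear triv triv u"
    unfolding vlinear_def
    using u_closed by (auto simp: u triv_simps bil algebra_simps)
  moreover have "u (amult triv a b) = amult triv (u a) (u b)" for a b
    by (cases a; cases b) (simp add: u triv_simps fun_eq_iff coc comm mult.assoc add_ac)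
  moreover have "u (aone triv) = aone triv"
    by (simp add: u triv_simps hochschild_cocycle_one[OF \<Phi>])
  ultimately have "algebra_automorphism triv u"
    unfolding algebra_automorphism_def by blast
  moreover have "nakayama_jacobian triv canonical_form u = (t, \<Phi> 1)"
  proof (rule nakayama_jacobian_eqI)
    show "(t, \<Phi> 1) \<in> vcarrier triv"
      by (simp add: triv_simps linear_dual_iff bil)
    \<comment> \<open>The cocycle identity with first argument 1 reads \<Phi>(1, xy) = \<Phi>(x, y)
      + \<Phi>(y, x), which accounts for the terms without a functional from D(B).\<close>
    show "canonical_form (u a) (u b) = canonical_form (amult triv (t, \<Phi> 1) a) b" for a b
      by (cases a; cases b) (simp add: u triv_simps coc[of 1] comm add_ac)
  qed
  ultimately show ?thesis by metis
qed

section \<open>Central units and cocycles from automorphisms\<close>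

lemma automorphism_trace:
  assumes u: "algebra_automorphism triv u" and fin: "finite_dimensional scale"
  shows "\<exists>t. \<forall>x. \<forall>f\<in>linear_dual scale. snd (u (x, f)) 1 = snd (u (x, \<lambda>b. 0)) 1 + f t"
proof -
  have closed: "u a \<in> vcarrier triv" if "a \<in> vcarrier triv" for a
    using u that unfolding algebra_automorphism_def vlinear_def by blast
  have add: "u (vadd triv a b) = vadd triv (u a) (u b)"
    if "a \<in> vcarrier triv" "b \<in> vcarrier triv" for a b
    using u that unfolding algebra_automorphism_def vlinear_def by blast
  have scl: "u (vscale triv c a) = vscale triv c (u a)" if "a \<in> vcarrier triv" for a c
    using u that unfolding algebra_automorphism_def vlinear_def by blast
  have snd_add: "snd (vadd triv a b) 1 = snd a 1 + snd b 1" for a b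
    by (cases a; cases b) (simp add: triv_simps)
  have snd_scale: "snd (vscale triv c a) 1 = c * snd a 1" for a c
    by (cases a) (simp add: triv_simps)
  \<comment> \<open>The trace composed with u, restricted to D(B), is a functional on the dual of B
    and hence evaluation at some t. This t becomes the component of the Jacobian in B.\<close>
  define F where "F f = snd (u (0, f)) 1" for f
  have "\<exists>t. \<forall>f\<in>linear_dual scale. F f = f t"
  proof (rule functional_on_dual_is_evaluation[OF fin])
    fix f g :: "'b \<Rightarrow> 'k" and c
    assume f: "f \<in> linear_dual scale"
    show "F (\<lambda>b. c * f b) = c * F f"
      using scl[of "(0, f)" c] f snd_scale[of c "u (0, f)"] by (simp add: F_def triv_simps)
    assume g: "g \<in> linear_dual scale"
    show "F (\<lambda>b. f b + g b) = F f + F g"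
      using add[of "(0, f)" "(0, g)"] f g snd_add[of "u (0, f)" "u (0, g)"]
      by (simp add: F_def triv_simps)
  qed
  then obtain t where t: "\<And>f. f \<in> linear_dual scale \<Longrightarrow> F f = f t" by blast
  have "snd (u (x, f)) 1 = snd (u (x, \<lambda>b. 0)) 1 + f t" if "f \<in> linear_dual scale" for x f
    using add[of "(x, \<lambda>b. 0)" "(0, f)"] that zero_dual snd_add[of "u (x, \<lambda>b. 0)" "u (0, f)"] t[OF that]
    by (simp add: F_def triv_simps)
  then show ?thesis by blast
qed

lemma jacobian_imp_central_unit_cocycle:
  assumes u: "algebra_automorphism triv u" and fin: "finite_dimensional scale"
  shows "\<exists>t \<Phi>. nakayama_jacobian triv canonical_form u = (t, \<Phi> 1) \<and> central_unit t \<and>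
           hochschild_cocycle scale \<Phi>"
proof -
  have bij: "bij_betw u (vcarrier triv) (vcarrier triv)"
    and mult: "\<And>a b. a \<in> vcarrier triv \<Longrightarrow> b \<in> vcarrier triv \<Longrightarrow>
        u (amult triv a b) = amult triv (u a) (u b)"
    and one: "u (1, \<lambda>b. 0) = (1, \<lambda>b. 0)"
    and lin: "vlinear triv triv u"
    using u unfolding algebra_automorphism_def by (auto simp: triv_simps)
  define \<alpha> where "\<alpha> x = fst (u (x, \<lambda>b. 0))" for x
  define \<delta> where "\<delta> x = snd (u (x, \<lambda>b. 0))" for x
  have u_B: "u (x, \<lambda>b. 0) = (\<alpha> x, \<delta> x)" for x
    by (simp add: \<alpha>_def \<delta>_def)
  have B_in: "(x, \<lambda>b. 0) \<in> vcarrier triv" for x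
    using zero_dual by (simp add: triv_simps)
  have \<delta>: "\<delta> x \<in> linear_dual scale" for x
    using lin B_in[of x] unfolding vlinear_def by (metis u_B mem_Sigma_iff triv_simps(1))
  have add: "\<alpha> (x + y) = \<alpha> x + \<alpha> y" "\<delta> (x + y) = (\<lambda>b. \<delta> x b + \<delta> y b)" for x y
  proof -
    have "u (vadd triv (x, \<lambda>b. 0) (y, \<lambda>b. 0)) = vadd triv (u (x, \<lambda>b. 0)) (u (y, \<lambda>b. 0))"
      using lin B_in unfolding vlinear_def by blast
    then show "\<alpha> (x + y) = \<alpha> x + \<alpha> y" "\<delta> (x + y) = (\<lambda>b. \<delta> x b + \<delta> y b)"
      by (simp_all add: triv_simps u_B)
  qed
  have scl: "\<alpha> (scale c x) = scale c (\<alpha> x)" "\<delta> (scale c x) = (\<lambda>b. c * \<delta> x b)" for c x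
  proof -
    have "u (vscale triv c (x, \<lambda>b. 0)) = vscale triv c (u (x, \<lambda>b. 0))"
      using lin B_in unfolding vlinear_def by blast
    then show "\<alpha> (scale c x) = scale c (\<alpha> x)" "\<delta> (scale c x) = (\<lambda>b. c * \<delta> x b)"
      by (simp_all add: triv_simps u_B)
  qed
  have mul: "\<alpha> (x * y) = \<alpha> x * \<alpha> y" "\<delta> (x * y) = (\<lambda>b. \<delta> y (b * \<alpha> x) + \<delta> x (\<alpha> y * b))" for x y
    using mult[OF B_in B_in, of x y] by (simp_all add: triv_simps u_B)
  have \<alpha>_one: "\<alpha> 1 = 1"
    using one by (simp add: u_B)

  \<comment> \<open>The component \<open>\<delta>\<close> is a derivation along the endomorphism \<open>\<alpha>\<close>, which need not be bijective;
    precomposing its values with \<open>\<alpha>\<close> makes it an honest derivation with the same trace.\<close>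
  define \<Phi> where "\<Phi> b x = \<delta> x (\<alpha> b)" for b x
  have \<Phi>: "hochschild_cocycle scale \<Phi>"
    unfolding hochschild_cocycle_def bilinear_map_def
    using \<delta> by (auto simp: \<Phi>_def add scl mul linear_dual_iff)
  have \<Phi>_one: "\<Phi> 1 x = \<delta> x 1" for x
    by (simp add: \<Phi>_def \<alpha>_one)

  obtain t where t: "\<And>x f. f \<in> linear_dual scale \<Longrightarrow> snd (u (x, f)) 1 = \<delta> x 1 + f t"
    using automorphism_trace[OF u fin] by (auto simp: \<delta>_def)
  let ?j = "(t, \<Phi> 1)"
  have j_in: "?j \<in> vcarrier triv"
    using \<Phi> by (auto simp: triv_simps linear_dual_iff hochschild_cocycle_def bilinear_map_def)
  \<comment> \<open>The pairing of u(a) and u(b) is the trace of u(ab). By the choice of t this is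
    the pairing of \<open>?j\<close> with ab, and associativity moves a to the other side.\<close>
  have form: "canonical_form (u a) (u b) = canonical_form (amult triv ?j a) b"
    if ab: "a \<in> vcarrier triv" "b \<in> vcarrier triv" for a b
  proof -
    have "canonical_form (u a) (u b) = snd (u (amult triv a b)) 1"
      using mult[OF ab] by (simp add: canonical_form_eq_trace)
    also have "\<dots> = canonical_form ?j (amult triv a b)"
      using amult_closed[OF ab] t \<Phi>_one
      by (cases "amult triv a b") (simp add: triv_simps)
    finally show ?thesis by (simp add: canonical_form_assoc)
  qed
  have jac: "nakayama_jacobian triv canonical_form u = ?j"
    by (rule nakayama_jacobian_eqI[OF j_in form])

  have central: "t * y = y * t" for y
  proof (rule linear_dual_separates)
    fix f assume f: "f \<in> linear_dual scale"
    then have a: "(0, f) \<in> vcarrier triv" by (simp add: triv_simps)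
    \<comment> \<open>Both sides are the pairing of the two images under u, in opposite orders. They
      evaluate to f(yt) and f(ty), up to the same value of the cocycle at 0.\<close>
    have "canonical_form (amult triv ?j (0, f)) (y, \<lambda>b. 0) =
        canonical_form (amult triv ?j (y, \<lambda>b. 0)) (0, f)"
      using form[OF a B_in[of y]] form[OF B_in[of y] a] canonical_form_commute by metis
    then show "f (t * y) = f (y * t)"
      by (simp add: triv_simps)
  qed

  \<comment> \<open>Here the Jacobian annihilates (0, f), so u(0, f) pairs to zero with the image of
    u, which is all of A. The zero element is carried along in \<open>form0\<close>, so that
    non-degeneracy gives u(0, f) = u(0, 0) and injectivity of u finishes.\<close>
  have inj: "f = (\<lambda>b. 0)" if f: "f \<in> linear_dual scale" "\<And>b. f (b * t) = 0" for f
  proof -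
    have a: "(0, f) \<in> vcarrier triv" using f by (simp add: triv_simps)
    have form0: "canonical_form (u a) (u b) = 0"
      if "a \<in> {(0, f), (0, \<lambda>b. 0)}" "b \<in> vcarrier triv" for a b
    proof -
      have "canonical_form (u a) (u b) = canonical_form (amult triv ?j a) b"
        using form a B_in[of 0] that by blast
      also have "\<dots> = 0"
      proof -
        have "\<Phi> 1 0 = 0"
          using scl(2)[of 0 0] by (simp add: \<Phi>_one)
        then show ?thesis
          using that f by (cases b) (auto simp: triv_simps linear_dual_zero)
      qed
      finally show ?thesis .
    qed
    have "u (0, f) = u (0, \<lambda>b. 0)"
    proof (rule canonical_form_nondegenerate)
      show "u (0, f) \<in> vcarrier triv" "u (0, \<lambda>b. 0) \<in> vcarrier triv"
        using lin a B_in unfolding vlinear_def by blast+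
      fix c assume "c \<in> vcarrier triv"
      then obtain b where b: "b \<in> vcarrier triv" "c = u b"
        using bij unfolding bij_betw_def by blast
      have "canonical_form (u (0, f)) (u b) = 0" "canonical_form (u (0, \<lambda>b. 0)) (u b) = 0"
        using form0[OF _ b(1)] by blast+
      then show "canonical_form (u (0, f)) c = canonical_form (u (0, \<lambda>b. 0)) c"
        by (simp add: b)
    qed
    then have "(0 :: 'b, f) = (0, \<lambda>b. 0)"
      using bij a B_in unfolding bij_betw_def inj_on_def by blast
    then show ?thesis by simp
  qed
  \<comment> \<open>If 1 were outside Bt, some functional would vanish on Bt and take the value 1 at
    1, against \<open>inj\<close>. So t has a left inverse, which is two-sided because t is
    central.\<close>
  have "subspace (range (\<lambda>b. b * t))"
    unfolding subspace_def
    by (auto simp: image_iff scale_mult_left[symmetric] distrib_right[symmetric] intro: exI[of _ 0])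
  moreover have "\<not> (\<exists>f\<in>linear_dual scale. (\<forall>w\<in>range (\<lambda>b. b * t). f w = 0) \<and> f 1 = 1)"
    using inj by (metis rangeI zero_neq_one)
  ultimately have "1 \<in> range (\<lambda>b. b * t)"
    using exists_functional_separating by blast
  then obtain s where "s * t = 1" by (metis imageE)
  then have "central_unit t"
    unfolding central_unit_def using central by metis
  with jac \<Phi> show ?thesis by blast
qed

end

section \<open>The characterisation of the Jacobians\<close>

theorem proposition7:
  fixes scale :: "'k::field \<Rightarrow> 'b::{ring,monoid_mult} \<Rightarrow> 'b"
    and a :: "'b \<times> ('b \<Rightarrow> 'k)"
  assumes "algebra_over_field scale"
    and "finite_dimensional scale"
    and "a \<in> vcarrier (trivial_extension scale)"
  shows "(\<exists>u. algebra_automorphism (trivial_extension scale) u \<and>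
              a = nakayama_jacobian (trivial_extension scale) canonical_form u) \<longleftrightarrow>
         (\<exists>t \<tau>. a = (t, \<tau>) \<and> central_unit t \<and> \<tau> \<in> linear_dual scale \<and>
              \<tau> \<in> HH0_dual_pullback scale ` (connes_transpose scale ` vdual (HH1 scale)))"
proof -
  interpret algebra_over_field scale by (fact assms(1))
  obtain t \<tau> where a: "a = (t, \<tau>)" "\<tau> \<in> linear_dual scale"
    using assms(3) by (auto simp: triv_simps)
  have "(\<exists>u. algebra_automorphism triv u \<and> a = nakayama_jacobian triv canonical_form u) \<longleftrightarrow>
      central_unit t \<and> (\<exists>\<Phi>. hochschild_cocycle scale \<Phi> \<and> \<tau> = \<Phi> 1)"
    using jacobian_imp_central_unit_cocycle[OF _ assms(2)] central_unit_cocycle_imp_jacobian a(1)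
    by (metis prod.inject)
  then show ?thesis
    using a by (auto simp: connes_transpose_image_iff)
qed

end
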